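(* For every $N\in\mathbb{Z}$, the Somos 4 sequence $(A_n)_{n\in\mathbb{Z}}$ defined by $$A_{n+4}A_n=\alpha\,A_{n+3}A_{n+1}+\beta\,(A_{n+2})^2,\qquad \alpha=-\frac1N,\quad \beta=1,$$ with initial data $A_1=A_4=1$, $A_2=-N$, $A_3=N$, consists entirely of integers: $A_n\in\mathbb{Z}$ for all $n\in\mathbb{Z}$.
   Context: The recurrence is iterated forwards and backwards from $A_1,A_2,A_3,A_4$. Treating $N$ as an indeterminate, this gives elements $A_n\in\mathbb{Q}(N)$, $n\in\mathbb{Z}$ (the sequence begins $1,-N,N,1,1+N^2,N,N^3+2N,\dots$ at $n=1,2,\dots$). For a particular integer $N$, the sequence is the sequence of values of these functions at that integer; this is the meaning of the sequence when a zero term occurs in the course of the iteration (e.g. $A_0=0$ for $N=1$), and also when $N=0$, where the recurrence itself does not make sense. *)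

theory Defs
  imports
    "HOL-Computational_Algebra.Fraction_Field"
    "HOL-Computational_Algebra.Polynomial"
    "HOL-Number_Theory.Cong"
begin

section \<open>Somos 4 sequences indexed by the integers\<close>

fun somos4_iter :: "'a::field \<Rightarrow> 'a \<Rightarrow> 'a \<Rightarrow> 'a \<Rightarrow> 'a \<Rightarrow> 'a \<Rightarrow> nat \<Rightarrow> 'a" where
  "somos4_iter \<alpha> \<beta> a b c d 0 = a"
| "somos4_iter \<alpha> \<beta> a b c d (Suc 0) = b"
| "somos4_iter \<alpha> \<beta> a b c d (Suc (Suc 0)) = c"
| "somos4_iter \<alpha> \<beta> a b c d (Suc (Suc (Suc 0))) = d"
| "somos4_iter \<alpha> \<beta> a b c d (Suc (Suc (Suc (Suc n)))) =
     (\<alpha> * somos4_iter \<alpha> \<beta> a b c d (Suc (Suc (Suc n))) * somos4_iter \<alpha> \<beta> a b c d (Suc n)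
       + \<beta> * (somos4_iter \<alpha> \<beta> a b c d (Suc (Suc n)))\<^sup>2) / somos4_iter \<alpha> \<beta> a b c d n"

text \<open>
  The recurrence is invariant under reversing the order of the sequence, so iterating it
  backwards from the terms with indices 1, 2, 3, 4 is the same as iterating it forwards from
  these terms in the opposite order; step \<open>k\<close> of the reversed iteration is the term with
  index \<open>4 - k\<close>. As division by zero gives zero, this is a solution of the recurrence only as
  long as no term vanishes; see \<open>somos4_recurrence\<close> and \<open>somosA_recurrence\<close> below.
\<close>

definition somos4 :: "'a::field \<Rightarrow> 'a \<Rightarrow> 'a \<Rightarrow> 'a \<Rightarrow> 'a \<Rightarrow> 'a \<Rightarrow> int \<Rightarrow> 'a" where
  "somos4 \<alpha> \<beta> a1 a2 a3 a4 n =
     (if n \<ge> 1 then somos4_iter \<alpha> \<beta> a1 a2 a3 a4 (nat (n - 1))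
      else somos4_iter \<alpha> \<beta> a4 a3 a2 a1 (nat (4 - n)))"

section \<open>The sequence over the field of rational functions\<close>

text \<open>\<open>rat poly fract\<close> is the field of rational functions over the rationals in one
  indeterminate \<open>N\<close>.\<close>

definition ratfun_N :: "rat poly fract" where
  "ratfun_N = Fraction_Field.Fract [:0, 1:] 1"

definition somosA :: "int \<Rightarrow> rat poly fract" where
  "somosA = somos4 (- 1 / ratfun_N) 1 1 (- ratfun_N) ratfun_N 1"

text \<open>\<open>ratfun_has_value f x v\<close>: the rational function \<open>f\<close> has no pole at \<open>x\<close>, and its value
  there is \<open>v\<close>. The fraction \<open>p / q\<close> need not be the one produced by the iteration, so
  removable singularities are removed.\<close>

definition ratfun_has_value :: "rat poly fract \<Rightarrow> rat \<Rightarrow> rat \<Rightarrow> bool" where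
  "ratfun_has_value f x v \<longleftrightarrow>
     (\<exists>p q. f = Fraction_Field.Fract p q \<and> poly q x \<noteq> 0 \<and> v = poly p x / poly q x)"

lemma ratfun_has_value_unique:
  assumes "ratfun_has_value f x v" "ratfun_has_value f x w"
  shows "v = w"
proof -
  obtain p q where 1: "f = Fraction_Field.Fract p q" "poly q x \<noteq> 0" "v = poly p x / poly q x"
    using assms(1) unfolding ratfun_has_value_def by blast
  obtain r s where 2: "f = Fraction_Field.Fract r s" "poly s x \<noteq> 0" "w = poly r x / poly s x"
    using assms(2) unfolding ratfun_has_value_def by blast
  have "q \<noteq> 0" "s \<noteq> 0" using 1 2 by auto
  hence "p * s = r * q" using 1(1) 2(1) by (simp add: eq_fract)
  hence "poly p x * poly s x = poly r x * poly q x" by (metis poly_mult)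
  thus ?thesis using 1 2 by (simp add: frac_eq_eq)
qed

section \<open>The recurrence holds at all indices\<close>

lemma somos4_iter_rec:
  assumes "somos4_iter \<alpha> \<beta> a b c d k \<noteq> 0"
  shows "somos4_iter \<alpha> \<beta> a b c d (k + 4) * somos4_iter \<alpha> \<beta> a b c d k =
    \<alpha> * somos4_iter \<alpha> \<beta> a b c d (k + 3) * somos4_iter \<alpha> \<beta> a b c d (k + 1)
      + \<beta> * (somos4_iter \<alpha> \<beta> a b c d (k + 2))\<^sup>2"
  using assms by (simp add: eval_nat_numeral)

lemma somos4_forward:
  "n \<ge> 1 \<Longrightarrow> somos4 \<alpha> \<beta> a1 a2 a3 a4 n = somos4_iter \<alpha> \<beta> a1 a2 a3 a4 (nat (n - 1))"
  by (simp add: somos4_def)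

lemma somos4_backward:
  assumes "n \<le> 4"
  shows "somos4 \<alpha> \<beta> a1 a2 a3 a4 n = somos4_iter \<alpha> \<beta> a4 a3 a2 a1 (nat (4 - n))"
proof (cases "n \<ge> 1")
  case True
  hence "n = 1 \<or> n = 2 \<or> n = 3 \<or> n = 4" using assms by auto
  thus ?thesis by (auto simp: somos4_def eval_nat_numeral)
qed (simp add: somos4_def)

lemma somos4_recurrence:
  assumes nz: "\<And>m. somos4 \<alpha> \<beta> a1 a2 a3 a4 m \<noteq> 0"
  shows "somos4 \<alpha> \<beta> a1 a2 a3 a4 (n + 4) * somos4 \<alpha> \<beta> a1 a2 a3 a4 n =
    \<alpha> * somos4 \<alpha> \<beta> a1 a2 a3 a4 (n + 3) * somos4 \<alpha> \<beta> a1 a2 a3 a4 (n + 1)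
      + \<beta> * (somos4 \<alpha> \<beta> a1 a2 a3 a4 (n + 2))\<^sup>2"
proof (cases "n \<ge> 1")
  case True
  define k where "k = nat (n - 1)"
  have e: "nat (n + 4 - 1) = k + 4" "nat (n + 3 - 1) = k + 3" "nat (n + 2 - 1) = k + 2"
    "nat (n + 1 - 1) = k + 1" "nat (n - 1) = k"
    using True by (auto simp: k_def)
  have "somos4_iter \<alpha> \<beta> a1 a2 a3 a4 k \<noteq> 0"
    using nz[of n] True by (simp add: somos4_forward k_def)
  from somos4_iter_rec[OF this] show ?thesis
    using True by (simp only: somos4_forward e)
next
  case False
  define k where "k = nat (- n)"
  have e: "nat (4 - (n + 4)) = k" "nat (4 - (n + 3)) = k + 1" "nat (4 - (n + 2)) = k + 2"
    "nat (4 - (n + 1)) = k + 3" "nat (4 - n) = k + 4"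
    using False by (auto simp: k_def)
  have le: "n + 4 \<le> 4" "n + 3 \<le> 4" "n + 2 \<le> 4" "n + 1 \<le> 4" "n \<le> 4"
    using False by auto
  have "somos4_iter \<alpha> \<beta> a4 a3 a2 a1 k \<noteq> 0"
    using nz[of "n + 4"] somos4_backward[OF le(1), of \<alpha> \<beta> a1 a2 a3 a4] e(1) by simp
  from somos4_iter_rec[OF this] show ?thesis
    by (simp only: somos4_backward[OF le(1)] somos4_backward[OF le(2)]
        somos4_backward[OF le(3)] somos4_backward[OF le(4)] somos4_backward[OF le(5)] e
        mult.commute mult.left_commute mult.assoc)
qed

text \<open>
  No \<open>somosA n\<close> is the zero function: modulo the prime 7 and at \<open>N = 5\<close> the sequence is
  periodic with period 18 and without zeros. \<open>ratfun_res f c\<close> says that \<open>f\<close> is regular there,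
  with residue \<open>c\<close>.
\<close>

definition ratfun_res :: "rat poly fract \<Rightarrow> int \<Rightarrow> bool" where
  "ratfun_res f c \<longleftrightarrow> (\<exists>p q :: int poly.
     f = Fraction_Field.Fract (map_poly of_int p) (map_poly of_int q) \<and>
     \<not> 7 dvd poly q 5 \<and> [poly p 5 = c * poly q 5] (mod 7))"

lemma prime7: "prime (7 :: int)"
proof -
  have "{2..<7 :: int} = {2, 3, 4, 5, 6}" by auto
  thus ?thesis by (auto simp: prime_int_iff')
qed

lemma ratfun_res_cong: "ratfun_res f c \<Longrightarrow> [c = d] (mod 7) \<Longrightarrow> ratfun_res f d"
  unfolding ratfun_res_def
  by (elim exE conjE, intro exI conjI, assumption, assumption)
    (meson cong_scalar_right cong_trans)

lemma map_poly_of_int_nz: "\<not> 7 dvd poly q (5::int) \<Longrightarrow> map_poly (of_int :: int \<Rightarrow> rat) q \<noteq> 0"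
  by (auto simp: poly_eq_iff coeff_map_poly)
    (metis dvd_0_right poly_0 poly_eqI coeff_0)

lemma map_poly_of_int_mult:
  "map_poly (of_int :: int \<Rightarrow> rat) (p * q) = map_poly of_int p * map_poly of_int q"
  by (rule poly_eqI) (simp add: coeff_map_poly coeff_mult)

lemma map_poly_of_int_add:
  "map_poly (of_int :: int \<Rightarrow> rat) (p + q) = map_poly of_int p + map_poly of_int q"
  by (rule poly_eqI) (simp add: coeff_map_poly)

lemma ratfun_res_mult:
  assumes "ratfun_res f c" "ratfun_res g d"
  shows "ratfun_res (f * g) (c * d)"
proof -
  obtain p q where 1: "f = Fraction_Field.Fract (map_poly of_int p) (map_poly of_int q)"
    "\<not> 7 dvd poly q (5::int)" "[poly p 5 = c * poly q 5] (mod 7)"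
    using assms(1) unfolding ratfun_res_def by blast
  obtain r s where 2: "g = Fraction_Field.Fract (map_poly of_int r) (map_poly of_int s)"
    "\<not> 7 dvd poly s (5::int)" "[poly r 5 = d * poly s 5] (mod 7)"
    using assms(2) unfolding ratfun_res_def by blast
  have "[poly p 5 * poly r 5 = (c * poly q 5) * (d * poly s 5)] (mod 7)"
    using 1 2 by (intro cong_mult)
  hence "[poly (p * r) 5 = (c * d) * poly (q * s) 5] (mod 7)"
    by (simp add: algebra_simps)
  moreover have "\<not> 7 dvd poly (q * s) (5::int)"
    using 1 2 prime7 by (simp add: prime_dvd_mult_iff)
  moreover have "f * g = Fraction_Field.Fract (map_poly of_int (p * r)) (map_poly of_int (q * s))"
    using 1 2 by (simp add: map_poly_of_int_mult)
  ultimately show ?thesis unfolding ratfun_res_def by blast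
qed

lemma ratfun_res_add:
  assumes "ratfun_res f c" "ratfun_res g d"
  shows "ratfun_res (f + g) (c + d)"
proof -
  obtain p q where 1: "f = Fraction_Field.Fract (map_poly of_int p) (map_poly of_int q)"
    "\<not> 7 dvd poly q (5::int)" "[poly p 5 = c * poly q 5] (mod 7)"
    using assms(1) unfolding ratfun_res_def by blast
  obtain r s where 2: "g = Fraction_Field.Fract (map_poly of_int r) (map_poly of_int s)"
    "\<not> 7 dvd poly s (5::int)" "[poly r 5 = d * poly s 5] (mod 7)"
    using assms(2) unfolding ratfun_res_def by blast
  have "[poly p 5 * poly s 5 + poly r 5 * poly q 5
      = (c * poly q 5) * poly s 5 + (d * poly s 5) * poly q 5] (mod 7)"
    using 1 2 by (intro cong_mult cong_add cong_refl)
  hence "[poly (p * s + r * q) 5 = (c + d) * poly (q * s) 5] (mod 7)"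
    by (simp add: algebra_simps)
  moreover have "\<not> 7 dvd poly (q * s) (5::int)"
    using 1 2 prime7 by (simp add: prime_dvd_mult_iff)
  moreover have "f + g =
      Fraction_Field.Fract (map_poly of_int (p * s + r * q)) (map_poly of_int (q * s))"
    using 1 2 map_poly_of_int_nz[of q] map_poly_of_int_nz[of s]
    by (simp add: map_poly_of_int_mult map_poly_of_int_add)
  ultimately show ?thesis unfolding ratfun_res_def by blast
qed

lemma ratfun_res_inverse:
  assumes "ratfun_res f c" "[c * d = 1] (mod 7)"
  shows "ratfun_res (inverse f) d"
proof -
  obtain p q where 1: "f = Fraction_Field.Fract (map_poly of_int p) (map_poly of_int q)"
    "\<not> 7 dvd poly q (5::int)" "[poly p 5 = c * poly q 5] (mod 7)"
    using assms(1) unfolding ratfun_res_def by blast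
  have "\<not> 7 dvd c"
  proof
    assume "7 dvd c"
    hence "[c * d = 0] (mod 7)" by (simp add: cong_0_iff)
    hence "[1 = (0::int)] (mod 7)" using assms(2) by (meson cong_sym cong_trans)
    thus False by (simp add: cong_def)
  qed
  hence "\<not> 7 dvd c * poly q 5" using 1(2) prime7 by (simp add: prime_dvd_mult_iff)
  hence a: "\<not> 7 dvd poly p (5::int)" using 1(3) by (simp add: cong_dvd_iff)
  have "[d * poly p 5 = d * (c * poly q 5)] (mod 7)" using 1(3) by (rule cong_scalar_left)
  also have "d * (c * poly q 5) = (c * d) * poly q 5" by simp
  also have "[(c * d) * poly q 5 = 1 * poly q 5] (mod 7)" using assms(2) by (rule cong_scalar_right)
  finally have "[poly q 5 = d * poly p 5] (mod 7)" by (simp add: cong_sym)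
  thus ?thesis using a 1(1) unfolding ratfun_res_def by auto
qed

lemma ratfun_res_nz:
  assumes "ratfun_res f c" "\<not> 7 dvd c"
  shows "f \<noteq> 0"
proof
  assume "f = 0"
  obtain p q where 1: "f = Fraction_Field.Fract (map_poly of_int p) (map_poly of_int q)"
    "\<not> 7 dvd poly q (5::int)" "[poly p 5 = c * poly q 5] (mod 7)"
    using assms(1) unfolding ratfun_res_def by blast
  have "map_poly (of_int :: int \<Rightarrow> rat) p = 0"
    using 1(1,2) \<open>f = 0\<close> map_poly_of_int_nz[of q] by (simp add: Zero_fract_def eq_fract)
  hence "p = 0" using map_poly_of_int_nz by (auto simp: poly_eq_iff coeff_map_poly)
  hence "[c * poly q 5 = 0] (mod 7)" using 1(3) by (simp add: cong_sym)
  hence "7 dvd c * poly q 5" by (simp add: cong_0_iff)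
  thus False using 1(2) assms(2) prime7 by (simp add: prime_dvd_mult_iff)
qed

lemma ratfun_res_const: "ratfun_res 1 1"
  unfolding ratfun_res_def
  by (intro exI[of _ 1]) (simp add: One_fract_def)

lemma ratfun_res_N: "ratfun_res ratfun_N 5"
  unfolding ratfun_res_def
  by (rule exI[of _ "[:0, 1:]"], rule exI[of _ 1]) (simp add: ratfun_N_def map_poly_pCons)

lemma ratfun_res_minus1: "ratfun_res (- 1) (- 1)"
  unfolding ratfun_res_def
  by (rule exI[of _ "[:- 1:]"], rule exI[of _ 1])
    (simp add: One_fract_def map_poly_pCons eq_fract one_pCons)

lemma ratfun_res_alpha: "ratfun_res (- 1 / ratfun_N) 4"
proof -
  have "ratfun_res (- 1 * inverse ratfun_N) (- 1 * 3)"
    by (intro ratfun_res_mult ratfun_res_minus1 ratfun_res_inverse[OF ratfun_res_N])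
      (simp add: cong_def)
  hence "ratfun_res (- 1 * inverse ratfun_N) 4"
    by (rule ratfun_res_cong) (simp add: cong_def)
  thus ?thesis by (simp add: divide_inverse)
qed

text \<open>The residues over one period, starting with the one of \<open>somosA 1\<close>.\<close>

definition somosA_residues :: "int list" where
  "somosA_residues = [1, 2, 5, 1, 5, 5, 2, 2, 6, 2, 5, 6, 4, 2, 3, 4, 5, 3]"

definition somosA_res :: "int \<Rightarrow> int" where
  "somosA_res n = somosA_residues ! nat ((n - 1) mod 18)"

lemma somosA_res_cases:
  obtains j :: int where "j \<in> {0..<18}" "\<And>i. somosA_res (n + i) = somosA_res (j + 1 + i)"
proof -
  have "(n - 1) mod 18 \<in> {0..<18}" by simp
  moreover have "somosA_res (n + i) = somosA_res ((n - 1) mod 18 + 1 + i)" for i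
  proof -
    have "((n - 1) mod 18 + 1 + i - 1) mod 18 = ((n - 1) mod 18 + i) mod 18"
      by (simp add: algebra_simps)
    also have "\<dots> = (n - 1 + i) mod 18" by (simp add: mod_add_left_eq)
    also have "n - 1 + i = n + i - 1" by simp
    finally show ?thesis by (simp add: somosA_res_def)
  qed
  ultimately show ?thesis using that by blast
qed

lemma somosA_res_props:
  "\<not> 7 dvd somosA_res n"
  "[somosA_res (n + 4) * somosA_res n =
     4 * somosA_res (n + 3) * somosA_res (n + 1) + (somosA_res (n + 2))\<^sup>2] (mod 7)"
proof -
  obtain j where j: "j \<in> {0..<18 :: int}"
    and e: "\<And>i. somosA_res (n + i) = somosA_res (j + 1 + i)"
    using somosA_res_cases[of n] by metis
  have "j \<in> {0,1,2,3,4,5,6,7,8,9,10,11,12,13,14,15,16,17}"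
    using j unfolding insert_iff empty_iff atLeastLessThan_iff by presburger
  hence "\<not> 7 dvd somosA_res (j + 1 + 0) \<and>
    [somosA_res (j + 1 + 4) * somosA_res (j + 1 + 0) =
     4 * somosA_res (j + 1 + 3) * somosA_res (j + 1 + 1) + (somosA_res (j + 1 + 2))\<^sup>2] (mod 7)"
    by (elim insertE emptyE; hypsubst) (simp_all add: somosA_res_def somosA_residues_def cong_def)
  thus "\<not> 7 dvd somosA_res n"
    "[somosA_res (n + 4) * somosA_res n =
     4 * somosA_res (n + 3) * somosA_res (n + 1) + (somosA_res (n + 2))\<^sup>2] (mod 7)"
    unfolding e[symmetric] by simp_all
qed

lemma coprime7: "\<not> 7 dvd (x::int) \<Longrightarrow> coprime x 7"
  using prime7 prime_imp_coprime[of 7 x] by (simp add: coprime_commute)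

lemma ratfun_res_iter:
  fixes r :: "nat \<Rightarrow> int"
  assumes nz: "\<And>k. \<not> 7 dvd r k"
    and rec: "\<And>k. [r (k + 4) * r k = 4 * r (k + 3) * r (k + 1) + (r (k + 2))\<^sup>2] (mod 7)"
    and init: "ratfun_res a (r 0)" "ratfun_res b (r 1)" "ratfun_res c (r 2)" "ratfun_res d (r 3)"
  shows "ratfun_res (somos4_iter (- 1 / ratfun_N) 1 a b c d k) (r k)"
proof (induction k rule: less_induct)
  case (less k)
  show ?case
  proof (cases "k < 4")
    case True
    hence "k = 0 \<or> k = 1 \<or> k = 2 \<or> k = 3" by auto
    thus ?thesis using init by (auto simp: eval_nat_numeral)
  next
    case False
    then obtain m where m: "k = m + 4" by (metis add.commute le_Suc_ex not_le)
    obtain x where x: "[r m * x = 1] (mod 7)"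
      using cong_solve_coprime_int[OF coprime7[OF nz]] by blast
    let ?S = "somos4_iter (- 1 / ratfun_N) 1 a b c d"
    have ih: "ratfun_res (?S m) (r m)" "ratfun_res (?S (m + 1)) (r (m + 1))"
      "ratfun_res (?S (m + 2)) (r (m + 2))" "ratfun_res (?S (m + 3)) (r (m + 3))"
      using less.IH m by auto
    have "ratfun_res ((- 1 / ratfun_N * ?S (m + 3) * ?S (m + 1) + ?S (m + 2) * ?S (m + 2))
        * inverse (?S m)) ((4 * r (m + 3) * r (m + 1) + r (m + 2) * r (m + 2)) * x)"
      using ih x
      by (intro ratfun_res_mult ratfun_res_add ratfun_res_alpha ratfun_res_inverse[of _ "r m"])
    moreover have "?S k = (- 1 / ratfun_N * ?S (m + 3) * ?S (m + 1) + ?S (m + 2) * ?S (m + 2))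
        * inverse (?S m)"
      unfolding m by (simp add: eval_nat_numeral divide_inverse)
    moreover have "[(4 * r (m + 3) * r (m + 1) + r (m + 2) * r (m + 2)) * x = r k] (mod 7)"
    proof -
      have "[(4 * r (m + 3) * r (m + 1) + r (m + 2) * r (m + 2)) * x = (r (m + 4) * r m) * x] (mod 7)"
        using rec[of m] by (intro cong_scalar_right) (simp add: cong_sym power2_eq_square)
      also have "(r (m + 4) * r m) * x = r k * (r m * x)" by (simp add: m)
      also have "[r k * (r m * x) = r k * 1] (mod 7)" using x by (rule cong_scalar_left)
      finally show ?thesis by simp
    qed
    ultimately show ?thesis by (metis ratfun_res_cong)
  qed
qed

lemma ratfun_res_init:
  "ratfun_res 1 (somosA_res 1)" "ratfun_res (- ratfun_N) (somosA_res 2)"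
  "ratfun_res ratfun_N (somosA_res 3)" "ratfun_res 1 (somosA_res 4)"
proof -
  have "ratfun_res (- 1 * ratfun_N) (- 1 * 5)"
    by (intro ratfun_res_mult ratfun_res_minus1 ratfun_res_N)
  hence "ratfun_res (- 1 * ratfun_N) 2"
    by (rule ratfun_res_cong) (simp add: cong_def)
  thus "ratfun_res (- ratfun_N) (somosA_res 2)"
    by (simp add: somosA_res_def somosA_residues_def)
qed (simp_all add: somosA_res_def somosA_residues_def ratfun_res_const ratfun_res_N)

lemma somosA_nonzero: "somosA n \<noteq> 0"
proof (cases "n \<ge> 1")
  case True
  define r where "r k = somosA_res (int k + 1)" for k
  have "ratfun_res (somos4_iter (- 1 / ratfun_N) 1 1 (- ratfun_N) ratfun_N 1 (nat (n - 1)))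
      (r (nat (n - 1)))"
  proof (rule ratfun_res_iter)
    show "[r (k + 4) * r k = 4 * r (k + 3) * r (k + 1) + (r (k + 2))\<^sup>2] (mod 7)" for k
      using somosA_res_props(2)[of "int k + 1"] by (simp add: r_def algebra_simps)
  qed (use ratfun_res_init somosA_res_props(1) in \<open>simp_all add: r_def\<close>)
  thus ?thesis using True ratfun_res_nz somosA_res_props(1)
    unfolding somosA_def r_def by (metis somos4_forward)
next
  case False
  define r where "r k = somosA_res (4 - int k)" for k
  have "ratfun_res (somos4_iter (- 1 / ratfun_N) 1 1 ratfun_N (- ratfun_N) 1 (nat (4 - n)))
      (r (nat (4 - n)))"
  proof (rule ratfun_res_iter)
    show "[r (k + 4) * r k = 4 * r (k + 3) * r (k + 1) + (r (k + 2))\<^sup>2] (mod 7)" for k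
      using somosA_res_props(2)[of "- int k"] by (simp add: r_def algebra_simps)
  qed (use ratfun_res_init somosA_res_props(1) in \<open>simp_all add: r_def\<close>)
  moreover have "n \<le> 4" using False by simp
  ultimately show ?thesis using ratfun_res_nz somosA_res_props(1)
    unfolding somosA_def r_def by (metis somos4_backward)
qed

lemma somosA_recurrence:
  "somosA (n + 4) * somosA n =
     (- 1 / ratfun_N) * somosA (n + 3) * somosA (n + 1) + 1 * (somosA (n + 2))\<^sup>2"
  unfolding somosA_def
  by (rule somos4_recurrence) (use somosA_nonzero in \<open>simp add: somosA_def\<close>)

lemma somosA_initial:
  "somosA 1 = 1" "somosA 2 = - ratfun_N" "somosA 3 = ratfun_N" "somosA 4 = 1"
  by (simp_all add: somosA_def somos4_def eval_nat_numeral)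

end

theory Submission
  imports Defs "HOL-Computational_Algebra.Polynomial_Factorial"
begin

text \<open>
  The recurrence of order four has the pole \<open>\<alpha> = - 1 / N\<close>, but every nowhere vanishing solution of
  such a recurrence also satisfies one of order five,
  \<open>A (n + 5) * A n + \<beta> * A (n + 4) * A (n + 1) = \<kappa> * A (n + 3) * A (n + 2)\<close>,
  in which \<open>\<kappa>\<close> is a constant of the orbit (\<open>somos4_quintic\<close>). For the sequence at hand
  \<open>\<beta> = 1\<close> and \<open>\<kappa> = - N\<^sup>2\<close>, so the coefficients are now polynomials (\<open>somosA_quintic\<close>).

  The initial terms \<open>A 2\<close> and \<open>A 3\<close> are still divisible by \<open>N\<close>. This is removed by writing
  \<open>A n = N ^ e n * B n\<close> with \<open>e n = 1\<close> for \<open>n\<close> congruent to 2 or 3 modulo 4, and \<open>e n = 0\<close>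
  otherwise. Then \<open>B\<close> satisfies a relation of order five whose coefficients are \<open>- 1\<close> and minus
  a power of \<open>N\<close> that depends on \<open>n\<close> modulo 4 (\<open>somosB_quintic\<close>), and \<open>B 1, \<dots>, B 4\<close>
  are \<open>1\<close> or \<open>- 1\<close>. It remains to see that all further divisions are exact in the
  factorial ring \<open>\<int>[N]\<close>.

  This is Gale's argument for Somos sequences. Reducing five consecutive instances of the relation
  modulo a term \<open>B m\<close> shows that the numerator of \<open>B (m + 5)\<close>, multiplied by
  \<open>B (m - 1) * \<dots> * B (m - 4)\<close>, is a multiple of \<open>B m\<close> (\<open>somos5_division\<close>). A prime that
  divides two nearby terms would, by the relation, divide two nearby earlier terms or the
  coefficient, which is a power of \<open>N\<close>; hence nearby terms are coprime (\<open>somos5_coprime\<close>)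
  as soon as \<open>N\<close> divides no term. The latter holds because the value of \<open>B n\<close> at \<open>N = 0\<close> is
  plus or minus a power of two, given in closed form by \<open>somosB_const\<close>.

  The relation for \<open>B\<close> is invariant under \<open>n \<mapsto> 5 - n\<close>, so the same argument applies in both
  directions (\<open>somosB_integral\<close>). Finally, a polynomial with integer coefficients takes an
  integer value at every integer \<open>N\<close>.
\<close>

section \<open>A relation of order five\<close>

text \<open>
  Eliminating \<open>a0\<close> from the left side and \<open>a6\<close> from the right side gives the same expression
  in \<open>a1, \<dots>, a5\<close>.
\<close>

lemma somos4_quintic_balance:
  fixes a0 :: "'a::comm_ring_1"
  assumes "a4 * a0 = \<alpha> * a3 * a1 + \<beta> * a2\<^sup>2"
    and "a6 * a2 = \<alpha> * a5 * a3 + \<beta> * a4\<^sup>2"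
  shows "(a5 * a0 + \<beta> * a4 * a1) * a4 = (a6 * a1 + \<beta> * a5 * a2) * a2"
proof -
  have "(a5 * a0 + \<beta> * a4 * a1) * a4 = a5 * (a4 * a0) + \<beta> * a4 * a1 * a4"
    by (simp add: algebra_simps)
  also have "\<dots> = \<alpha> * a3 * (a5 * a1) + \<beta> * (a5 * a2\<^sup>2 + a4\<^sup>2 * a1)"
    unfolding assms(1) by (simp add: algebra_simps power2_eq_square)
  also have "\<dots> = a1 * (a6 * a2) + \<beta> * a5 * a2 * a2"
    unfolding assms(2) by (simp add: algebra_simps power2_eq_square)
  finally show ?thesis by (simp add: algebra_simps)
qed

text \<open>
  By the balance above, the quotient of the left side by \<open>x (n + 3) * x (n + 2)\<close> does not change
  from \<open>n\<close> to \<open>n + 1\<close>, so its value \<open>\<kappa>\<close> may be read off at any single index \<open>m\<close>.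
\<close>

lemma somos4_quintic:
  fixes x :: "int \<Rightarrow> 'a::field"
  assumes nz: "\<And>n. x n \<noteq> 0"
    and rec: "\<And>n. x (n + 4) * x n = \<alpha> * x (n + 3) * x (n + 1) + \<beta> * (x (n + 2))\<^sup>2"
    and start: "x (m + 5) * x m + \<beta> * x (m + 4) * x (m + 1) = \<kappa> * x (m + 3) * x (m + 2)"
  shows "x (n + 5) * x n + \<beta> * x (n + 4) * x (n + 1) = \<kappa> * x (n + 3) * x (n + 2)"
proof -
  have bal: "(x (n + 5) * x n + \<beta> * x (n + 4) * x (n + 1)) * x (n + 4)
      = (x (n + 6) * x (n + 1) + \<beta> * x (n + 5) * x (n + 2)) * x (n + 2)" for n
    using somos4_quintic_balance rec[of n] rec[of "n + 2"]
    by (simp add: add.assoc)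
  show ?thesis
  proof (induction n rule: int_induct[where k = m])
    case base
    show ?case by (rule start)
  next
    case (step1 i)
    have "(x (i + 6) * x (i + 1) + \<beta> * x (i + 5) * x (i + 2)) * x (i + 2)
        = (\<kappa> * x (i + 4) * x (i + 3)) * x (i + 2)"
      unfolding bal[symmetric] step1.IH by (simp add: algebra_simps)
    hence "x (i + 6) * x (i + 1) + \<beta> * x (i + 5) * x (i + 2) = \<kappa> * x (i + 4) * x (i + 3)"
      using nz by simp
    thus ?case by (simp add: add.assoc)
  next
    case (step2 i)
    have "(x (i - 1 + 5) * x (i - 1) + \<beta> * x (i - 1 + 4) * x (i - 1 + 1)) * x (i - 1 + 4)
        = (x (i + 5) * x i + \<beta> * x (i + 4) * x (i + 1)) * x (i + 1)"
      using bal[of "i - 1"] by (simp add: algebra_simps)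
    also have "\<dots> = (\<kappa> * x (i - 1 + 3) * x (i - 1 + 2)) * x (i - 1 + 4)"
      unfolding step2.IH by (simp add: algebra_simps)
    finally show ?case using nz[of "i - 1 + 4"] by simp
  qed
qed

section \<open>Exactness of the divisions\<close>

lemma coprime_of_sum:
  fixes a :: "'a::ring_gcd"
  assumes "a * t = - u - v" "b dvd u" "coprime v b"
  shows "coprime a b"
proof (rule coprimeI)
  fix c assume c: "c dvd a" "c dvd b"
  have "v = - u - a * t" using assms(1) by simp
  moreover have "c dvd u" using c(2) assms(2) by (rule dvd_trans)
  ultimately have "c dvd v" using c(1) by simp
  thus "is_unit c" using c(2) assms(3) coprime_common_divisor by blast
qed

text \<open>
  The relation expresses a multiple of the new term \<open>a5\<close> as a sum of two products. Each of
  \<open>a1, \<dots>, a4\<close> is a factor of one of them and coprime to the other.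
\<close>

lemma somos5_coprime_step:
  fixes a0 :: "'a::ring_gcd"
  assumes rec: "a5 * a0 = - (a4 * a1) - s * a3 * a2"
    and "coprime a2 a1" "coprime a3 a1" "coprime a4 a1"
    and "coprime a3 a2" "coprime a4 a2" "coprime a4 a3"
    and "coprime s a1" "coprime s a4"
  shows "coprime a5 a1" "coprime a5 a2" "coprime a5 a3" "coprime a5 a4"
proof -
  have rec': "a5 * a0 = - (s * a3 * a2) - a4 * a1" using rec by simp
  show "coprime a5 a1" "coprime a5 a4"
    by (rule coprime_of_sum[OF rec]; use assms in \<open>simp add: coprime_commute\<close>)+
  show "coprime a5 a2" "coprime a5 a3"
    by (rule coprime_of_sum[OF rec']; use assms in \<open>simp add: coprime_commute\<close>)+
qed

text \<open>
  The exactness of the division that produces the term after \<open>a9\<close>; the coefficients have period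
  four, so \<open>s0\<close> and \<open>s1\<close> occur again. The numerator is treated modulo \<open>a5\<close>, where the five
  relations lose one summand each. Multiplying by \<open>a4 * a3\<close>, then by \<open>a2\<close>, then by \<open>a1\<close> makes
  the terms \<open>a9\<close> and \<open>a8\<close>, then \<open>a7\<close>, then \<open>a6\<close> accessible to the relations. Apart from
  monomial factors, the numerator \<open>E\<close> thereby becomes \<open>F\<close>, then \<open>G\<close>, and in the end the
  numerator of \<open>a5\<close> itself.
\<close>

lemma somos5_division:
  fixes a0 :: "'a::ring_gcd"
  assumes e0: "a5 * a0 = - (a4 * a1) - s0 * a3 * a2"
    and e1: "a6 * a1 = - (a5 * a2) - s1 * a4 * a3"
    and e2: "a7 * a2 = - (a6 * a3) - s2 * a5 * a4"
    and e3: "a8 * a3 = - (a7 * a4) - s3 * a6 * a5"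
    and e4: "a9 * a4 = - (a8 * a5) - s0 * a7 * a6"
    and cop: "coprime a5 a1" "coprime a5 a2" "coprime a5 a3" "coprime a5 a4"
  shows "a5 dvd - (a9 * a6) - s1 * a8 * a7"
proof -
  define E where "E = - (a9 * a6) - s1 * a8 * a7"
  define F where "F = s0 * a3 * a6\<^sup>2 + s1 * a4\<^sup>2 * a7"
  define G where "G = s0 * a2 * a6 - s1 * a4\<^sup>2"
  have "G * a1 = s0 * a2 * (a6 * a1) - s1 * a4\<^sup>2 * a1"
    by (simp add: G_def algebra_simps)
  also have "\<dots> = s1 * a4 * (- (a4 * a1) - s0 * a3 * a2) - a5 * (s0 * a2\<^sup>2)"
    unfolding e1 by (simp add: algebra_simps power2_eq_square)
  finally have "G * a1 = a5 * (s1 * a4 * a0 - s0 * a2\<^sup>2)"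
    unfolding e0[symmetric] by (simp add: algebra_simps)
  hence "a5 dvd G * a1" by (rule dvdI)
  hence G: "a5 dvd G" using cop(1) by (simp add: coprime_dvd_mult_left_iff)
  have "F * a2 = s0 * a2 * a3 * a6\<^sup>2 + s1 * a4\<^sup>2 * (a7 * a2)"
    by (simp add: F_def algebra_simps)
  also have "\<dots> = G * (a6 * a3) - a5 * (s1 * s2 * a4 * a4\<^sup>2)"
    unfolding e2 by (simp add: G_def algebra_simps power2_eq_square)
  finally have "a5 dvd F * a2" using G by simp
  hence F: "a5 dvd F" using cop(2) by (simp add: coprime_dvd_mult_left_iff)
  have "E * a4 * a3 = - (a6 * a3 * (a9 * a4)) - s1 * a7 * a4 * (a8 * a3)"
    by (simp add: E_def algebra_simps)
  also have "\<dots> = F * a7 + a5 * (a6 * a3 * a8 + s1 * s3 * a7 * a4 * a6)"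
    unfolding e3 e4 by (simp add: F_def algebra_simps power2_eq_square)
  finally have "a5 dvd E * a4 * a3" using F by simp
  thus ?thesis using cop(3,4) by (simp add: coprime_dvd_mult_left_iff E_def)
qed

section \<open>Integer polynomials among the rational functions\<close>

definition int_ratfun :: "int poly \<Rightarrow> rat poly fract" where
  "int_ratfun p = Fraction_Field.Fract (map_poly of_int p) 1"

lemma int_ratfun_mult: "int_ratfun (p * q) = int_ratfun p * int_ratfun q"
  by (simp add: int_ratfun_def map_poly_of_int_mult)

lemma int_ratfun_add: "int_ratfun (p + q) = int_ratfun p + int_ratfun q"
  by (simp add: int_ratfun_def map_poly_of_int_add)

lemma int_ratfun_0: "int_ratfun 0 = 0"
  by (simp add: int_ratfun_def Zero_fract_def)

lemma int_ratfun_1: "int_ratfun 1 = 1"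
  by (simp add: int_ratfun_def One_fract_def)

lemma int_ratfun_minus: "int_ratfun (- p) = - int_ratfun p"
  using int_ratfun_add[of p "- p"] by (simp add: int_ratfun_0 eq_neg_iff_add_eq_0 add.commute)

lemma int_ratfun_diff: "int_ratfun (p - q) = int_ratfun p - int_ratfun q"
  using int_ratfun_add[of p "- q"] by (simp add: int_ratfun_minus)

lemma int_ratfun_power: "int_ratfun (p ^ k) = int_ratfun p ^ k"
  by (induction k) (simp_all add: int_ratfun_1 int_ratfun_mult)

lemmas int_ratfun_hom = int_ratfun_mult int_ratfun_add int_ratfun_0 int_ratfun_1
  int_ratfun_minus int_ratfun_diff int_ratfun_power

lemma int_ratfun_N: "int_ratfun [:0, 1:] = ratfun_N"
  by (simp add: int_ratfun_def ratfun_N_def map_poly_pCons)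

lemma int_ratfun_inject: "int_ratfun p = int_ratfun q \<longleftrightarrow> p = q"
  by (auto simp: int_ratfun_def eq_fract poly_eq_iff coeff_map_poly)

lemma int_ratfun_has_value:
  "ratfun_has_value (int_ratfun p) (of_int N) (of_int (poly p N))"
proof -
  have "poly (map_poly of_int p) (of_int N :: rat) = of_int (poly p N)"
    by (induction p) (simp_all add: map_poly_pCons)
  thus ?thesis unfolding ratfun_has_value_def int_ratfun_def
    by (intro exI[of _ "map_poly of_int p"] exI[of _ 1]) simp
qed

text \<open>
  The indeterminate is a prime element of \<open>\<int>[N]\<close>, and it divides exactly the polynomials
  without constant term.
\<close>

lemma coprime_X_power:
  fixes p :: "int poly"
  assumes "poly p 0 \<noteq> 0"
  shows "coprime ([:0, 1:] ^ k) p"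
proof -
  have "coprime [:0, 1:] p"
  proof (rule coprimeI)
    fix c assume c: "c dvd [:0, 1:]" "c dvd p"
    obtain a q where p: "p = pCons a q" by (cases p)
    have "p = [:a:] + [:0, 1:] * q" by (simp add: p)
    hence "c dvd [:a:]" using c by (metis dvd_add_left_iff dvd_mult2)
    moreover have "a \<noteq> 0" using assms p by simp
    ultimately have "degree c = 0" using dvd_imp_degree_le[of c "[:a:]"] by simp
    then obtain e where e: "c = [:e:]" by (metis degree_eq_zeroE)
    have "e dvd coeff [:0, 1:] 1" using c(1) unfolding e const_poly_dvd_iff by blast
    thus "is_unit c" by (simp add: e is_unit_const_poly_iff)
  qed
  thus ?thesis by simp
qed

section \<open>Integral sequences of order five\<close>

text \<open>
  A window of four consecutive pairwise coprime terms is enough to add the next term; the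
  first windows are harmless as they consist, apart from the term with index 0, of units.
  The bound \<open>m\<close> is there because integrality and coprimality are established by the same
  induction, during which only the terms before \<open>m\<close> are known to be polynomials.
\<close>

lemma somos5_coprime:
  fixes P :: "nat \<Rightarrow> int poly"
  assumes rec: "\<And>k. k + 5 < m \<Longrightarrow>
      P (k + 5) * P k = - (P (k + 4) * P (k + 1)) - [:0, 1:] ^ d k * P (k + 3) * P (k + 2)"
    and unit: "\<And>k. k \<in> {1..4} \<Longrightarrow> k < m \<Longrightarrow> P k dvd 1"
    and nz: "\<And>k. k < m \<Longrightarrow> poly (P k) 0 \<noteq> 0"
  shows "i < j \<Longrightarrow> j \<le> i + 4 \<Longrightarrow> j < m \<Longrightarrow> coprime (P j) (P i)"
proof (induction j arbitrary: i rule: less_induct)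
  case (less j)
  show ?case
  proof (cases "j \<le> 4")
    case True
    hence "P j dvd 1" using less.prems by (intro unit) auto
    thus ?thesis by (rule is_unit_left_imp_coprime)
  next
    case False
    define k where "k = j - 5"
    have j: "j = k + 5" using False by (simp add: k_def)
    have ih: "coprime (P (k + u)) (P (k + v))" if "v < u" "u \<le> 4" "v \<ge> 1" for u v
      using less.IH[of "k + u" "k + v"] less.prems that j by simp
    have X: "coprime ([:0, 1:] ^ d k) (P (k + u))" if "u \<le> 4" for u
      using less.prems that j by (intro coprime_X_power nz) simp
    have r: "P (k + 5) * P k = - (P (k + 4) * P (k + 1)) - [:0, 1:] ^ d k * P (k + 3) * P (k + 2)"
      using less.prems j by (intro rec) simp
    have "i = k + 1 \<or> i = k + 2 \<or> i = k + 3 \<or> i = k + 4" using less.prems j by auto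
    thus ?thesis
      using somos5_coprime_step[OF r] ih[of 1 2] ih[of 1 3] ih[of 1 4] ih[of 2 3] ih[of 2 4]
        ih[of 3 4] X[of 1] X[of 4] by (auto simp: j coprime_commute)
  qed
qed

text \<open>
  The terms with indices 6 to 9 are obtained by dividing by units, later ones by
  \<open>somos5_division\<close>, which looks back ten terms. The integers \<open>b n\<close> are the constant terms of
  the polynomials. They are supplied from outside, as a nowhere vanishing solution of the relation
  at \<open>N = 0\<close>, since the relation by itself does not exclude that they become zero.
\<close>

theorem somos5_integral:
  fixes x :: "nat \<Rightarrow> rat poly fract" and b :: "nat \<Rightarrow> int"
  assumes rec: "\<And>k. x (k + 5) * x k =
      - (x (k + 4) * x (k + 1)) - ratfun_N ^ d k * x (k + 3) * x (k + 2)"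
    and per: "\<And>k. d (k + 4) = d k"
    and b_nz: "\<And>k. b k \<noteq> 0"
    and b_rec: "\<And>k. b (k + 5) * b k =
      - (b (k + 4) * b (k + 1)) - 0 ^ d k * b (k + 3) * b (k + 2)"
    and init: "\<And>k. k \<le> 5 \<Longrightarrow> x k = int_ratfun (p k) \<and> poly (p k) 0 = b k"
    and unit: "\<And>k. k \<in> {1..4} \<Longrightarrow> p k dvd 1"
  shows "\<exists>q. x n = int_ratfun q \<and> poly q 0 = b n"
proof (induction n rule: less_induct)
  case (less n)
  show ?case
  proof (cases "n \<le> 5")
    case True
    thus ?thesis using init by blast
  next
    case False
    define k where "k = n - 5"
    have n: "n = k + 5" and k: "k \<ge> 1" using False by (auto simp: k_def)
    obtain P where P: "\<And>i. i < n \<Longrightarrow> x i = int_ratfun (P i)"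
        and P0: "\<And>i. i < n \<Longrightarrow> poly (P i) 0 = b i"
      using less.IH by metis
    define E where "E i = - (P (i + 4) * P (i + 1)) - [:0, 1:] ^ d i * P (i + 3) * P (i + 2)" for i
    have E: "x (i + 5) * x i = int_ratfun (E i)" if "i + 5 \<le> n" for i
      using that rec[of i] by (simp add: P E_def int_ratfun_hom int_ratfun_N)
    have Prec: "P (i + 5) * P i = E i" if "i + 5 < n" for i
      using E[of i] that by (simp add: P int_ratfun_inject flip: int_ratfun_mult)
    have Punit: "P i dvd 1" if "i \<in> {1..4}" "i < n" for i
    proof -
      have "P i = p i" using P[of i] init[of i] that by (simp add: int_ratfun_inject)
      thus ?thesis using unit[OF that(1)] by simp
    qed
    have cop: "coprime (P j) (P i)" if "i < j" "j \<le> i + 4" "j < n" for i j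
      by (rule somos5_coprime[of n P d])
        (use Prec Punit P0 b_nz that in \<open>simp_all add: E_def\<close>)
    have "P k dvd E k"
    proof (cases "k \<le> 4")
      case True
      thus ?thesis using Punit[of k] k n by (auto intro: dvd_trans)
    next
      case False
      define l where "l = k - 5"
      have l: "k = l + 5" using False by (simp add: l_def)
      have "P (l + 5) dvd - (P (l + 9) * P (l + 6)) - [:0, 1:] ^ d (l + 1) * P (l + 8) * P (l + 7)"
      proof (rule somos5_division)
        show "P (l + 5) * P l = - (P (l + 4) * P (l + 1)) - [:0, 1:] ^ d l * P (l + 3) * P (l + 2)"
          using Prec[of l] n l by (simp add: E_def)
        show "P (l + 6) * P (l + 1) =
            - (P (l + 5) * P (l + 2)) - [:0, 1:] ^ d (l + 1) * P (l + 4) * P (l + 3)"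
          using Prec[of "l + 1"] n l by (simp add: E_def eval_nat_numeral)
        show "P (l + 7) * P (l + 2) =
            - (P (l + 6) * P (l + 3)) - [:0, 1:] ^ d (l + 2) * P (l + 5) * P (l + 4)"
          using Prec[of "l + 2"] n l by (simp add: E_def eval_nat_numeral)
        show "P (l + 8) * P (l + 3) =
            - (P (l + 7) * P (l + 4)) - [:0, 1:] ^ d (l + 3) * P (l + 6) * P (l + 5)"
          using Prec[of "l + 3"] n l by (simp add: E_def eval_nat_numeral)
        show "P (l + 9) * P (l + 4) =
            - (P (l + 8) * P (l + 5)) - [:0, 1:] ^ d l * P (l + 7) * P (l + 6)"
          using Prec[of "l + 4"] per[of l] n l by (simp add: E_def eval_nat_numeral)
      qed (use n l in \<open>auto intro: cop\<close>)
      thus ?thesis using per[of "l + 1"] by (simp add: l E_def eval_nat_numeral)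
    qed
    then obtain q where q: "E k = P k * q" by (elim dvdE)
    have nz: "x k \<noteq> 0"
    proof
      assume "x k = 0"
      hence "P k = 0" using P[of k] n by (simp add: int_ratfun_inject flip: int_ratfun_0)
      thus False using P0[of k] b_nz[of k] n by simp
    qed
    have "x n * x k = int_ratfun q * x k"
      using E[of k] by (simp add: n q int_ratfun_mult P mult.commute)
    hence "x n = int_ratfun q" using nz by simp
    moreover have "poly q 0 = b n"
    proof -
      have "poly q 0 * b k = poly (E k) 0" by (simp add: q P0 n mult.commute)
      also have "\<dots> = b n * b k"
        using b_rec[of k] by (simp add: E_def P0 n poly_power)
      finally show ?thesis using b_nz by simp
    qed
    ultimately show ?thesis by blast
  qed
qed

section \<open>The sequence divided by powers of the indeterminate\<close>

lemma somosA_next_terms: "somosA 5 = 1 + ratfun_N\<^sup>2" "somosA 6 = ratfun_N"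
  "somosA 0 = ratfun_N\<^sup>2 - 1"
proof -
  have N: "ratfun_N \<noteq> 0" using somosA_nonzero[of 3] by (simp add: somosA_initial)
  show 5: "somosA 5 = 1 + ratfun_N\<^sup>2"
    using somosA_recurrence[of 1] N by (simp add: somosA_initial)
  show "somosA 6 = ratfun_N"
    using somosA_recurrence[of 2] N by (simp add: somosA_initial 5 field_simps power2_eq_square)
  show "somosA 0 = ratfun_N\<^sup>2 - 1"
    using somosA_recurrence[of 0] N by (simp add: somosA_initial)
qed

lemma somosA_quintic:
  "somosA (n + 5) * somosA n =
     - (somosA (n + 4) * somosA (n + 1)) - ratfun_N\<^sup>2 * somosA (n + 3) * somosA (n + 2)"
proof -
  have "somosA (n + 5) * somosA n + 1 * somosA (n + 4) * somosA (n + 1)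
      = (- (ratfun_N\<^sup>2)) * somosA (n + 3) * somosA (n + 2)"
    by (rule somos4_quintic[OF somosA_nonzero somosA_recurrence, where m = 1])
      (simp add: somosA_initial somosA_next_terms algebra_simps power2_eq_square)
  thus ?thesis by (simp add: algebra_simps)
qed

text \<open>
  The order of vanishing of \<open>somosA n\<close> at \<open>N = 0\<close>, so that the terms \<open>somosB n\<close> below are
  neither zero nor infinite there.
\<close>

definition somosA_ord :: "int \<Rightarrow> nat" where
  "somosA_ord n = (if n mod 4 \<in> {2, 3} then 1 else 0)"

definition somosB :: "int \<Rightarrow> rat poly fract" where
  "somosB n = somosA n / ratfun_N ^ somosA_ord n"

definition somosB_exp :: "int \<Rightarrow> nat" where
  "somosB_exp n = (if n mod 4 = 0 then 4 else if n mod 4 = 2 then 0 else 2)"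

text \<open>
  The two products \<open>somosA (n + 5) * somosA n\<close> and \<open>somosA (n + 4) * somosA (n + 1)\<close> carry the
  same power \<open>D\<close> of \<open>N\<close>, and the third summand carries \<open>somosB_exp n \<ge> 0\<close> more.
\<close>

lemma somosB_quintic:
  "somosB (n + 5) * somosB n =
     - (somosB (n + 4) * somosB (n + 1)) - ratfun_N ^ somosB_exp n * somosB (n + 3) * somosB (n + 2)"
proof -
  have N: "ratfun_N \<noteq> 0" using somosA_nonzero[of 3] by (simp add: somosA_initial)
  have A: "somosA m = ratfun_N ^ somosA_ord m * somosB m" for m
    using N by (simp add: somosB_def)
  define D where "D = somosA_ord (n + 5) + somosA_ord n"
  obtain q r where n: "n = 4 * q + r" and r: "r \<in> {0..<4}"
    using that[of "n div 4" "n mod 4"] by simp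
  have periodic: "somosA_ord (4 * q + u) = somosA_ord u" "somosB_exp (4 * q + u) = somosB_exp u" for u
    by (simp_all add: somosA_ord_def somosB_exp_def)
  have "r = 0 \<or> r = 1 \<or> r = 2 \<or> r = 3" using r by auto
  hence D: "somosA_ord (n + 4) + somosA_ord (n + 1) = D"
    "2 + (somosA_ord (n + 3) + somosA_ord (n + 2)) = D + somosB_exp n"
    unfolding D_def n add.assoc periodic by (auto simp: somosA_ord_def somosB_exp_def)
  have "ratfun_N ^ D * (somosB (n + 5) * somosB n) = somosA (n + 5) * somosA n"
    by (simp add: A D_def power_add)
  also have "\<dots> = - (ratfun_N ^ (somosA_ord (n + 4) + somosA_ord (n + 1))
        * (somosB (n + 4) * somosB (n + 1)))
      - ratfun_N ^ (2 + (somosA_ord (n + 3) + somosA_ord (n + 2)))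
        * (somosB (n + 3) * somosB (n + 2))"
    unfolding somosA_quintic by (simp add: A power_add power2_eq_square)
  also have "\<dots> = ratfun_N ^ D * (- (somosB (n + 4) * somosB (n + 1))
      - ratfun_N ^ somosB_exp n * somosB (n + 3) * somosB (n + 2))"
    unfolding D by (simp add: power_add algebra_simps)
  finally show ?thesis using N by simp
qed

text \<open>
  The value of \<open>somosB n\<close> at \<open>N = 0\<close>. There the four terms with indices
  \<open>4 * k + 3, \<dots>, 4 * k + 6\<close> form a geometric progression with ratio \<open>(- 1) ^ k\<close>, and the
  relation that leads from one such block to the next makes the initial terms
  \<open>2 ^ (k * (k + 1) / 2)\<close>.
\<close>

definition somosB_const :: "int \<Rightarrow> int" where
  "somosB_const n = (let k = (n - 3) div 4 in
     (if odd k \<and> even n then - 1 else 1) * 2 ^ nat (k * (k + 1) div 2))"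

text \<open>
  At \<open>N = 0\<close> the third summand is present only for \<open>n = 4 * k + 6\<close>, where the other indices
  reach from the block of \<open>k\<close> to that of \<open>k + 2\<close>. There the two summands are equal, which
  accounts for the factor 2 in the relation between the powers of two; for other \<open>n\<close> only
  the sign matters, which changes with the ratio.
\<close>

lemma somosB_const_quintic:
  "somosB_const (n + 5) * somosB_const n =
     - (somosB_const (n + 4) * somosB_const (n + 1))
     - 0 ^ somosB_exp n * somosB_const (n + 3) * somosB_const (n + 2)"
proof -
  define t :: "int \<Rightarrow> int" where "t k = 2 ^ nat (k * (k + 1) div 2)" for k
  define k where "k = (n - 3) div 4"
  define i where "i = (n - 3) mod 4"
  have n: "n = 4 * k + i + 3" and i: "i \<in> {0, 1, 2, 3}"
    unfolding k_def i_def insert_iff empty_iff by presburger+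
  have const: "somosB_const (4 * m + r) = (if odd (m + (r - 3) div 4) \<and> even r then - 1 else 1)
      * t (m + (r - 3) div 4)" for m r
  proof -
    have "(4 * m + r - 3) div 4 = m + (r - 3) div 4" by presburger
    thus ?thesis by (simp add: somosB_const_def t_def Let_def)
  qed
  have t: "t (k + 2) * t k = 2 * (t (k + 1) * t (k + 1))"
  proof -
    have "even (k * (k + 1))" by simp
    then obtain h where h: "k * (k + 1) = 2 * h" by (elim evenE)
    have sq: "(k + 1) * (k + 1 + 1) = 2 * (h + k + 1)" "(k + 2) * (k + 2 + 1) = 2 * (h + 2 * k + 3)"
      using h by (simp_all add: algebra_simps)
    have nonneg: "m * (m + 1) \<ge> 0" for m :: int
      by (cases "m \<ge> 0") (simp_all add: mult_nonpos_nonpos)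
    have "h \<ge> 0" "h + k + 1 \<ge> 0" "h + 2 * k + 3 \<ge> 0"
      using nonneg[of k] nonneg[of "k + 1"] nonneg[of "k + 2"] unfolding h sq by simp_all
    hence "nat (h + 2 * k + 3) + nat h = 1 + nat (h + k + 1) + nat (h + k + 1)" by simp
    thus ?thesis unfolding t_def h sq by (simp flip: power_add power_Suc)
  qed
  have const': "somosB_const (n + j) =
      (if odd (k + (i + j) div 4) \<and> odd (i + j) then - 1 else 1) * t (k + (i + j) div 4)" for j
    using const[of k "i + 3 + j"] by (simp add: n add.assoc)
  have exp: "0 ^ somosB_exp n = (if i = 3 then 1 else 0 :: int)"
    using i by (auto simp: somosB_exp_def n)
  have "i = 0 \<or> i = 1 \<or> i = 2 \<or> i = 3" using i by simp
  thus ?thesis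
    unfolding exp const' const'[of 0, simplified] by (elim disjE; use t in simp)
qed

text \<open>
  For \<open>n \<ge> 0\<close> the sequence is read forwards from index 0, for \<open>n < 0\<close> backwards from index 5. In
  both cases the six initial terms are those with indices 0 to 5, and the middle four are
  units. Reversal leaves the relation unchanged because \<open>somosB_exp\<close> is an even function.
\<close>

lemma somosB_integral: "\<exists>q. somosB n = int_ratfun q"
proof -
  have B: "somosB 0 = ratfun_N\<^sup>2 - 1" "somosB 1 = 1" "somosB 2 = - 1" "somosB 3 = 1"
    "somosB 4 = 1" "somosB 5 = 1 + ratfun_N\<^sup>2"
    using somosA_nonzero[of 3]
    by (simp_all add: somosB_def somosA_ord_def somosA_initial somosA_next_terms)
  define p :: "nat \<Rightarrow> int poly" where "p k = [[:0, 1:]\<^sup>2 - 1, 1, - 1, 1, 1, 1 + [:0, 1:]\<^sup>2] ! k" for k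
  have p: "somosB (int k) = int_ratfun (p k) \<and> poly (p k) 0 = somosB_const (int k)" if "k \<le> 5" for k
  proof -
    have "k = 0 \<or> k = 1 \<or> k = 2 \<or> k = 3 \<or> k = 4 \<or> k = 5" using that by auto
    thus ?thesis
      by (auto simp: p_def B int_ratfun_hom int_ratfun_N somosB_const_def)
  qed
  have p_unit: "p k dvd 1" if "k \<in> {1..4}" for k
  proof -
    have "k = 1 \<or> k = 2 \<or> k = 3 \<or> k = 4" using that by auto
    thus ?thesis by (auto simp: p_def)
  qed
  have per: "somosB_exp (int (k + 4)) = somosB_exp (int k)" for k
    by (simp add: somosB_exp_def)
  have const_nz: "somosB_const m \<noteq> 0" for m
    by (simp add: somosB_const_def Let_def)
  show ?thesis
  proof (cases "n \<ge> 0")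
    case True
    have "\<exists>q. somosB (int (nat n)) = int_ratfun q \<and> poly q 0 = somosB_const (int (nat n))"
    proof (rule somos5_integral[where d = "\<lambda>k. somosB_exp (int k)" and p = p])
      show "somosB (int (k + 5)) * somosB (int k) =
          - (somosB (int (k + 4)) * somosB (int (k + 1)))
          - ratfun_N ^ somosB_exp (int k) * somosB (int (k + 3)) * somosB (int (k + 2))" for k
        using somosB_quintic[of "int k"] by (simp add: add.commute)
      show "somosB_const (int (k + 5)) * somosB_const (int k) =
          - (somosB_const (int (k + 4)) * somosB_const (int (k + 1)))
          - 0 ^ somosB_exp (int k) * somosB_const (int (k + 3)) * somosB_const (int (k + 2))" for k
        using somosB_const_quintic[of "int k"] by (simp add: add.commute)
    qed (use per const_nz p p_unit in blast)+
    thus ?thesis using True by auto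
  next
    case False
    define k where "k = nat (5 - n)"
    have sym: "somosB_exp (- int j) = somosB_exp (int j)" for j
      unfolding somosB_exp_def by presburger
    have "\<exists>q. somosB (5 - int k) = int_ratfun q \<and> poly q 0 = somosB_const (5 - int k)"
    proof (rule somos5_integral[where d = "\<lambda>k. somosB_exp (int k)" and p = "\<lambda>k. p (5 - k)"])
      show "somosB (5 - int (j + 5)) * somosB (5 - int j) =
          - (somosB (5 - int (j + 4)) * somosB (5 - int (j + 1)))
          - ratfun_N ^ somosB_exp (int j) * somosB (5 - int (j + 3)) * somosB (5 - int (j + 2))" for j
        using somosB_quintic[of "- int j"] by (simp add: sym algebra_simps)
      show "somosB_const (5 - int (j + 5)) * somosB_const (5 - int j) =
          - (somosB_const (5 - int (j + 4)) * somosB_const (5 - int (j + 1)))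
          - 0 ^ somosB_exp (int j) * somosB_const (5 - int (j + 3)) * somosB_const (5 - int (j + 2))" for j
        using somosB_const_quintic[of "- int j"] by (simp add: sym algebra_simps)
      show "somosB (5 - int j) = int_ratfun (p (5 - j)) \<and> poly (p (5 - j)) 0 = somosB_const (5 - int j)"
        if "j \<le> 5" for j using p[of "5 - j"] that by (simp add: of_nat_diff)
      show "p (5 - j) dvd 1" if "j \<in> {1..4}" for j
        using that by (intro p_unit) auto
    qed (use per const_nz in blast)+
    moreover have "5 - int k = n" using False by (simp add: k_def)
    ultimately show ?thesis by auto
  qed
qed

theorem corollary4p3:
  fixes N :: int
  shows "\<forall>n :: int. \<exists>a :: int. ratfun_has_value (somosA n) (of_int N) (of_int a)"
proof
  fix n :: int
  obtain q where q: "somosB n = int_ratfun q" using somosB_integral by blast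
  have "ratfun_N \<noteq> 0" using somosA_nonzero[of 3] by (simp add: somosA_initial)
  hence "somosA n = int_ratfun ([:0, 1:] ^ somosA_ord n * q)"
    using q by (simp add: somosB_def int_ratfun_hom int_ratfun_N field_simps)
  thus "\<exists>a :: int. ratfun_has_value (somosA n) (of_int N) (of_int a)"
    using int_ratfun_has_value by metis
qed

end
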